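(* Let $H$ be a separable infinite-dimensional real Hilbert space. Then for every Hilbert-Schmidt operator $T:H\to H$ and for any $\bar{x},\bar{y}\in H$ with $\bar{y}=T\bar{x}$, the following hold. (i) For any given nonempty subsets $U$ and $V$ of $H$, $T$ does not enjoy the covering property on $U$ relative to $V$, which implies that the exact covering bound of $T$ around $(\bar{x},\bar{y})$ is zero, that is, $\operatorname{cov}T(\bar{x},\bar{y})=0$. (ii) The covering constant of $T$ is constant with $\hat{\alpha}(T,\bar{x},\bar{y})=0$.
   Context: Let $H$ be a separable real Hilbert space with inner product $\langle\cdot,\cdot\rangle$, norm $\|\cdot\|_H$, and an orthonormal basis $\{e_i: i\in\mathbb{N}\}$. A linear continuous operator $T:H\to H$ is a Hilbert-Schmidt operator if $\sum_{i=1}^{\infty}\|Te_i\|_H^2<\infty$. $\mathbb{B}$ denotes the closed unit ball of $H$, and $\mathbb{B}(x,\eta)$ the closed ball with center $x$ and radius $\eta$. Covering property. Let $F:H\rightrightarrows H$ be a set-valued mapping with nonempty domain (a single-valued mapping $g$ is identified with $x\mapsto\{g(x)\}$), and let $U,V$ be nonempty subsets of $H$. $F$ enjoys the covering property on $U$ relative to $V$ if there is $\gamma>0$ such that $F(x)\cap V+\gamma r\mathbb{B}\subset F(x+r\mathbb{B})$ whenever $x+r\mathbb{B}\subset U$ and $r>0$. Given $(\bar{x},\bar{y})$ in the graph of $F$, $F$ has the local covering property around $(\bar{x},\bar{y})$ with modulus $\gamma>0$ if there are a neighborhood $U$ of $\bar{x}$ and a neighborhood $V$ of $\bar{y}$ such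 that this inclusion holds (with this $\gamma$) whenever $x+r\mathbb{B}\subset U$, $r>0$. The exact covering bound $\operatorname{cov}F(\bar{x},\bar{y})$ is the supremum of all such moduli $\gamma$ (taken to be $0$ if there are none). Mordukhovich derivative. For a continuous single-valued $g:H\to H$ and $x,y\in H$, $$\widehat{D}^*g(x)(y)=\left\{z\in H:\ \limsup_{u\to x}\frac{\langle z,u-x\rangle-\langle y,g(u)-g(x)\rangle}{\|u-x\|_H+\|g(u)-g(x)\|_H}\le 0\right\}.$$ Covering constant. For a single-valued $g:H\to H$ and $\bar{x},\bar{y}\in H$ with $\bar{y}=g(\bar{x})$, $$\hat{\alpha}(g,\bar{x},\bar{y})=\sup_{\eta>0}\inf\{\|z\|_H:\ z\in\widehat{D}^*g(x)(w),\ x\in\mathbb{B}(\bar{x},\eta),\ g(x)\in\mathbb{B}(\bar{y},\eta),\ \|w\|_H=1\}.$$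
   Formalization: In (i), U and V are also required to admit a ball x+rB contained in U with r>0 and Tx in V; otherwise (e.g. U a single point) the covering property holds vacuously and the claim is false. The claims cov T = 0 and covering constant = 0 are unrestricted. *)

theory Defs
  imports "HOL-Analysis.Analysis" "HOL-Library.Set_Algebras"
begin

text \<open>
  A real Hilbert space is a type of sort \<open>{real_inner, complete_space}\<close>.  The sums of sets
  are the Minkowski sums of \<open>HOL-Library.Set_Algebras\<close>.
\<close>

definition infinite_dimensional :: "'h::real_vector itself \<Rightarrow> bool" where
  "infinite_dimensional _ \<longleftrightarrow> \<not> (\<exists>B::'h set. finite B \<and> span B = UNIV)"

definition orthonormal_basis :: "(nat \<Rightarrow> 'h::real_inner) \<Rightarrow> bool" where
  "orthonormal_basis e \<longleftrightarrow>
     (\<forall>i j. inner (e i) (e j) = (if i = j then 1 else 0)) \<and> closure (span (range e)) = UNIV"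

definition Hilbert_Schmidt :: "(nat \<Rightarrow> 'h) \<Rightarrow> ('h::real_inner \<Rightarrow> 'h) \<Rightarrow> bool" where
  "Hilbert_Schmidt e T \<longleftrightarrow> bounded_linear T \<and> summable (\<lambda>i. (norm (T (e i)))\<^sup>2)"

definition as_set_valued :: "('a \<Rightarrow> 'b) \<Rightarrow> 'a \<Rightarrow> 'b set" where
  "as_set_valued g = (\<lambda>x. {g x})"

definition covers_with ::
  "real \<Rightarrow> ('h::real_normed_vector \<Rightarrow> 'h set) \<Rightarrow> 'h set \<Rightarrow> 'h set \<Rightarrow> bool" where
  "covers_with \<gamma> F U V \<longleftrightarrow>
     (\<forall>x r. r > 0 \<and> cball x r \<subseteq> U \<longrightarrow>
        F x \<inter> V + cball 0 (\<gamma> * r) \<subseteq> (\<Union>u\<in>cball x r. F u))"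

definition covering_property ::
  "('h::real_normed_vector \<Rightarrow> 'h set) \<Rightarrow> 'h set \<Rightarrow> 'h set \<Rightarrow> bool" where
  "covering_property F U V \<longleftrightarrow> (\<exists>\<gamma>>0. covers_with \<gamma> F U V)"

definition local_covering_modulus ::
  "('h::real_normed_vector \<Rightarrow> 'h set) \<Rightarrow> 'h \<Rightarrow> 'h \<Rightarrow> real \<Rightarrow> bool" where
  "local_covering_modulus F xbar ybar \<gamma> \<longleftrightarrow>
     \<gamma> > 0 \<and> (\<exists>U V. xbar \<in> interior U \<and> ybar \<in> interior V \<and> covers_with \<gamma> F U V)"

text \<open>In \<open>ennreal\<close> the supremum of the empty set is 0.\<close>

definition covering_bound ::
  "('h::real_normed_vector \<Rightarrow> 'h set) \<Rightarrow> 'h \<Rightarrow> 'h \<Rightarrow> ennreal" where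
  "covering_bound F xbar ybar = (SUP \<gamma>\<in>{\<gamma>. local_covering_modulus F xbar ybar \<gamma>}. ennreal \<gamma>)"

text \<open>
  The inclusion is only tested at balls contained in \<open>U\<close> whose centre has a value in \<open>V\<close>, so
  every mapping has the covering property on \<open>U\<close> relative to \<open>V\<close> if there is no such ball
  (for instance if \<open>U\<close> has empty interior).
\<close>

lemma covering_property_vacuous:
  assumes "\<not> (\<exists>x r. r > 0 \<and> cball x r \<subseteq> U \<and> F x \<inter> V \<noteq> {})"
  shows "covering_property F U V"
proof -
  have "covers_with 1 F U V"
    unfolding covers_with_def
  proof (intro allI impI)
    fix x r assume "(r::real) > 0 \<and> cball x r \<subseteq> U"
    then have "F x \<inter> V = {}" using assms by blast
    then show "F x \<inter> V + cball 0 (1 * r) \<subseteq> (\<Union>u\<in>cball x r. F u)"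
      by (auto elim: set_plus_elim)
  qed
  then show ?thesis unfolding covering_property_def by (intro exI[of _ 1]) simp
qed

definition Mordukhovich_derivative ::
  "('h::real_inner \<Rightarrow> 'h) \<Rightarrow> 'h \<Rightarrow> 'h \<Rightarrow> 'h set" where
  "Mordukhovich_derivative g x y =
     {z. Limsup (at x) (\<lambda>u. ereal ((inner z (u - x) - inner y (g u - g x)) /
                                     (norm (u - x) + norm (g u - g x)))) \<le> 0}"

text \<open>The infimum of the empty set is \<open>\<infinity>\<close>.\<close>

definition covering_constant ::
  "('h::real_inner \<Rightarrow> 'h) \<Rightarrow> 'h \<Rightarrow> 'h \<Rightarrow> ennreal" where
  "covering_constant g xbar ybar =
     (SUP \<eta>\<in>{0<..}. Inf {ennreal (norm z) | z x w.
        z \<in> Mordukhovich_derivative g x w \<and> x \<in> cball xbar \<eta> \<and> g x \<in> cball ybar \<eta> \<and>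
        norm w = 1})"

end

theory Submission
  imports Defs
begin

text \<open>
  A Hilbert-Schmidt operator \<open>T\<close> has an adjoint \<open>w \<mapsto> \<Sum>k. \<langle>w, T e\<^sub>k\<rangle> e\<^sub>k\<close>,
  and summing squared matrix coefficients in either order shows that
  \<open>\<Sum>n. \<parallel>T\<^sup>* e\<^sub>n\<parallel>\<^sup>2 \<le> \<Sum>k. \<parallel>T e\<^sub>k\<parallel>\<^sup>2\<close>; hence \<open>T\<^sup>* e\<^sub>n\<close> tends to 0.
  Covering with modulus \<open>\<gamma>\<close> would force \<open>\<gamma> \<le> \<parallel>T\<^sup>* w\<parallel>\<close> for all unit vectors \<open>w\<close>,
  and \<open>T\<^sup>* w\<close> belongs to the Mordukhovich derivative of \<open>T\<close> at \<open>w\<close>, so the unit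
  vectors \<open>e\<^sub>n\<close> settle both parts.
\<close>

definition orthonormal :: "(nat \<Rightarrow> 'h::real_inner) \<Rightarrow> bool" where
  "orthonormal e \<longleftrightarrow> (\<forall>i j. inner (e i) (e j) = (if i = j then 1 else 0))"

lemma orthonormal_inner: "orthonormal e \<Longrightarrow> inner (e i) (e j) = (if i = j then 1 else 0)"
  by (simp add: orthonormal_def)

lemma orthonormal_norm: "orthonormal e \<Longrightarrow> norm (e i) = 1"
  by (simp add: orthonormal_def norm_eq_sqrt_inner)

lemma inner_orthonormal_sum:
  assumes "orthonormal e" "finite A"
  shows "inner (\<Sum>k\<in>A. c k *\<^sub>R e k) (e j) = (if j \<in> A then c j else 0)"
  using assms by (simp add: inner_sum_left orthonormal_inner if_distrib cong: if_cong)

lemma norm_orthonormal_sum: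
  assumes "orthonormal e" "finite A"
  shows "(norm (\<Sum>k\<in>A. c k *\<^sub>R e k))\<^sup>2 = (\<Sum>k\<in>A. (c k)\<^sup>2)"
proof -
  have "(norm (\<Sum>k\<in>A. c k *\<^sub>R e k))\<^sup>2
      = (\<Sum>j\<in>A. c j * inner (\<Sum>k\<in>A. c k *\<^sub>R e k) (e j))"
    by (simp only: power2_norm_eq_inner inner_sum_right[of "\<Sum>k\<in>A. c k *\<^sub>R e k"] inner_scaleR_right)
  also have "\<dots> = (\<Sum>k\<in>A. (c k)\<^sup>2)"
    using assms by (intro sum.cong) (simp_all add: inner_orthonormal_sum power2_eq_square)
  finally show ?thesis .
qed

text \<open>With \<open>s\<close> the projection of \<open>x\<close> onto the span of the chosen
  vectors, \<open>inner s x\<close> and \<open>inner s s\<close> are both the sum on the left, so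
  expanding \<open>inner (x - s) (x - s)\<close> leaves the difference of the two sides.\<close>

lemma Bessel_inequality:
  assumes "orthonormal e" "finite A"
  shows "(\<Sum>k\<in>A. (inner (e k) x)\<^sup>2) \<le> (norm x)\<^sup>2"
proof -
  define s where "s = (\<Sum>k\<in>A. inner (e k) x *\<^sub>R e k)"
  have "inner s x = (\<Sum>k\<in>A. (inner (e k) x)\<^sup>2)"
    by (simp add: s_def inner_sum_left power2_eq_square)
  moreover have "inner s s = (\<Sum>k\<in>A. (inner (e k) x)\<^sup>2)"
    using norm_orthonormal_sum[OF assms] by (simp add: s_def power2_norm_eq_inner)
  moreover have "0 \<le> inner (x - s) (x - s)"
    by simp
  ultimately show ?thesis
    by (simp add: inner_diff inner_commute power2_norm_eq_inner)
qed

text \<open>By Pythagoras a block of the series has as its squared norm the same block of squared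
  coefficients; hence the partial sums are Cauchy, and completeness gives the limit.\<close>

lemma orthonormal_series_summable:
  fixes e :: "nat \<Rightarrow> 'h::{real_inner, complete_space}"
  assumes e: "orthonormal e" and c: "summable (\<lambda>k. (c k)\<^sup>2)"
  shows "summable (\<lambda>k. c k *\<^sub>R e k)"
proof -
  have "Cauchy (\<lambda>n. \<Sum>k<n. c k *\<^sub>R e k)"
  proof (rule CauchyI)
    fix \<epsilon> :: real assume "0 < \<epsilon>"
    \<comment> \<open>The tolerance is squared because blocks are compared through squared
      norms.\<close>
    then obtain M where M: "\<And>m n. m \<ge> M \<Longrightarrow> norm (\<Sum>k=m..<n. (c k)\<^sup>2) < \<epsilon>\<^sup>2"
      using c unfolding summable_Cauchy by (metis zero_less_power)
    have le: "norm ((\<Sum>k<m. c k *\<^sub>R e k) - (\<Sum>k<n. c k *\<^sub>R e k)) < \<epsilon>"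
      if "M \<le> n" "n \<le> m" for m n
    proof -
      have "(\<Sum>k<m. c k *\<^sub>R e k) - (\<Sum>k<n. c k *\<^sub>R e k) = (\<Sum>k=n..<m. c k *\<^sub>R e k)"
        using that sum_diff_nat_ivl[of 0 n m "\<lambda>k. c k *\<^sub>R e k"]
        by (simp add: atLeast0LessThan)
      moreover have "(norm (\<Sum>k=n..<m. c k *\<^sub>R e k))\<^sup>2 < \<epsilon>\<^sup>2"
        using M[OF that(1), of m] by (simp add: norm_orthonormal_sum[OF e] sum_nonneg)
      ultimately show ?thesis
        using \<open>0 < \<epsilon>\<close> by (simp add: power_less_imp_less_base)
    qed
    then have "norm ((\<Sum>k<m. c k *\<^sub>R e k) - (\<Sum>k<n. c k *\<^sub>R e k)) < \<epsilon>"
      if "m \<ge> M" "n \<ge> M" for m n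
      using that by (metis linear norm_minus_commute)
    then show "\<exists>M. \<forall>m\<ge>M. \<forall>n\<ge>M. norm ((\<Sum>k<m. c k *\<^sub>R e k) - (\<Sum>k<n. c k *\<^sub>R e k)) < \<epsilon>"
      by blast
  qed
  then show ?thesis
    by (simp add: summable_iff_convergent Cauchy_convergent)
qed

text \<open>Pythagoras for the partial sums passes to the limit by continuity of the norm.\<close>

lemma Parseval_sums:
  assumes e: "orthonormal e" and s: "(\<lambda>k. c k *\<^sub>R e k) sums z"
  shows "(\<lambda>k. (c k)\<^sup>2) sums (norm z)\<^sup>2"
  using tendsto_power[OF tendsto_norm[OF s[unfolded sums_def]], of 2]
  by (simp add: sums_def norm_orthonormal_sum[OF e])

text \<open>The set where \<open>f\<close> and \<open>g\<close> agree is closed and contains the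
  span. This extends the adjoint identity from basis vectors to the whole space.\<close>

lemma bounded_linear_eq_on_closure_span:
  assumes "bounded_linear f" "bounded_linear g"
    and "\<And>x. x \<in> S \<Longrightarrow> f x = g x" and "x \<in> closure (span S)"
  shows "f x = g x"
proof -
  have "closed {x. f x = g x}"
    using assms(1,2) by (intro closed_Collect_eq) (simp_all add: linear_continuous_on)
  moreover have "span S \<subseteq> {x. f x = g x}"
    using linear_eq_on[OF assms(1,2)[THEN bounded_linear.linear] _ assms(3)] by blast
  ultimately show ?thesis
    using assms(4) closure_minimal by blast
qed

text \<open>Here \<open>z\<close> is the adjoint at \<open>w\<close>. Its series converges because
  Cauchy-Schwarz bounds the k-th coefficient by \<open>norm w * norm (T (e k))\<close>. The second
  claim writes its norm in matrix coefficients, ready for the double sum.\<close>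

lemma Hilbert_Schmidt_adjoint:
  fixes e :: "nat \<Rightarrow> 'h::{real_inner, complete_space}"
  assumes basis: "orthonormal_basis e" and HS: "Hilbert_Schmidt e T"
  obtains z where "\<And>u. inner z u = inner w (T u)"
    and "(\<lambda>k. (inner w (T (e k)))\<^sup>2) sums (norm z)\<^sup>2"
proof -
  have e: "orthonormal e" and dense: "closure (span (range e)) = UNIV"
    using basis by (auto simp: orthonormal_basis_def orthonormal_def)
  have T: "bounded_linear T" and sT: "summable (\<lambda>k. (norm (T (e k)))\<^sup>2)"
    using HS by (auto simp: Hilbert_Schmidt_def)
  have "summable (\<lambda>k. (inner w (T (e k)))\<^sup>2)"
  proof (rule summable_comparison_test')
    show "summable (\<lambda>k. (norm w)\<^sup>2 * (norm (T (e k)))\<^sup>2)"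
      using sT by (rule summable_mult)
    show "norm ((inner w (T (e k)))\<^sup>2) \<le> (norm w)\<^sup>2 * (norm (T (e k)))\<^sup>2" for k
      using Cauchy_Schwarz_ineq[of w "T (e k)"] by (simp add: power2_norm_eq_inner)
  qed
  then obtain z where z: "(\<lambda>k. inner w (T (e k)) *\<^sub>R e k) sums z"
    using orthonormal_series_summable[OF e, THEN summable_sums] by meson
  have "inner z (e j) = inner w (T (e j))" for j
  proof -
    have "(\<lambda>k. inner (inner w (T (e k)) *\<^sub>R e k) (e j)) sums inner z (e j)"
      by (rule bounded_linear.sums[OF bounded_linear_inner_left z])
    moreover have "(\<lambda>k. inner (inner w (T (e k)) *\<^sub>R e k) (e j))
        = (\<lambda>k. if k = j then inner w (T (e k)) else 0)"
      by (auto simp: orthonormal_inner[OF e])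
    ultimately show ?thesis
      using sums_single[of j "\<lambda>k. inner w (T (e k))"] sums_unique2 by metis
  qed
  then have "inner z u = inner w (T u)" for u
    using bounded_linear_eq_on_closure_span[OF bounded_linear_inner_right[of z]
        bounded_linear_compose[OF bounded_linear_inner_right[of w] T], of "range e" u] dense
    by auto
  then show thesis
    using that Parseval_sums[OF e z] by blast
qed

lemma Hilbert_Schmidt_adjoint_null_sequence:
  fixes e :: "nat \<Rightarrow> 'h::{real_inner, complete_space}"
  assumes basis: "orthonormal_basis e" and HS: "Hilbert_Schmidt e T"
  obtains z where "\<And>n u. inner (z n) u = inner (e n) (T u)" and "z \<longlonglongrightarrow> 0"
proof -
  have e: "orthonormal e"
    using basis by (auto simp: orthonormal_basis_def orthonormal_def)
  have sT: "summable (\<lambda>k. (norm (T (e k)))\<^sup>2)"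
    using HS by (auto simp: Hilbert_Schmidt_def)
  have "\<exists>z. (\<forall>u. inner z u = inner (e n) (T u)) \<and>
      (\<lambda>k. (inner (e n) (T (e k)))\<^sup>2) sums (norm z)\<^sup>2" for n
    by (rule Hilbert_Schmidt_adjoint[OF basis HS, of "e n"]) blast
  then obtain z where z: "\<And>n u. inner (z n) u = inner (e n) (T u)"
    and s: "\<And>n. (\<lambda>k. (inner (e n) (T (e k)))\<^sup>2) sums (norm (z n))\<^sup>2"
    by metis
  \<comment> \<open>Only finitely many \<open>n\<close> are summed, so the sum moves inside the
    series over \<open>k\<close>; there Bessel applied to \<open>T (e k)\<close> bounds each term,
    uniformly in \<open>N\<close>.\<close>
  have "(\<Sum>n<N. (norm (z n))\<^sup>2) \<le> (\<Sum>k. (norm (T (e k)))\<^sup>2)" for N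
  proof (rule sums_le)
    show "(\<lambda>k. \<Sum>n<N. (inner (e n) (T (e k)))\<^sup>2) sums (\<Sum>n<N. (norm (z n))\<^sup>2)"
      by (intro sums_sum s)
    show "(\<Sum>n<N. (inner (e n) (T (e k)))\<^sup>2) \<le> (norm (T (e k)))\<^sup>2" for k
      by (simp add: Bessel_inequality[OF e])
    show "(\<lambda>k. (norm (T (e k)))\<^sup>2) sums (\<Sum>k. (norm (T (e k)))\<^sup>2)"
      using sT by (rule summable_sums)
  qed
  then have "summable (\<lambda>n. (norm (z n))\<^sup>2)"
    by (intro summableI_nonneg_bounded) auto
  then have "(\<lambda>n. sqrt ((norm (z n))\<^sup>2)) \<longlonglongrightarrow> sqrt 0"
    by (intro tendsto_real_sqrt summable_LIMSEQ_zero)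
  then have "z \<longlonglongrightarrow> 0"
    by (simp add: tendsto_norm_zero_iff)
  with z that show thesis by blast
qed

text \<open>Covering yields a point \<open>u\<close> of the ball whose image is \<open>T x\<close>
  shifted by \<gamma> r in the direction \<open>w\<close>. Pairing \<open>T (u - x)\<close> with
  \<open>w\<close> moves to \<open>z\<close>, and Cauchy-Schwarz with \<open>norm (u - x)\<close> at
  most \<open>r\<close> compares the two sides.\<close>

lemma covering_modulus_le_adjoint:
  assumes T: "linear T" and adj: "\<And>u. inner z u = inner w (T u)" and w: "norm w = 1"
    and cov: "covers_with \<gamma> (as_set_valued T) U V" and "\<gamma> > 0"
    and r: "r > 0" "cball x r \<subseteq> U" and V: "T x \<in> V"
  shows "\<gamma> \<le> norm z"
proof -
  have "(\<gamma> * r) *\<^sub>R w \<in> cball 0 (\<gamma> * r)"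
    using w \<open>\<gamma> > 0\<close> r by simp
  moreover have "T x \<in> as_set_valued T x \<inter> V"
    using V by (simp add: as_set_valued_def)
  ultimately have "T x + (\<gamma> * r) *\<^sub>R w \<in> (\<Union>u\<in>cball x r. as_set_valued T u)"
    using cov r set_plus_intro unfolding covers_with_def by blast
  then obtain u where u: "dist x u \<le> r" and "T u = T x + (\<gamma> * r) *\<^sub>R w"
    by (auto simp: as_set_valued_def)
  then have "T (u - x) = (\<gamma> * r) *\<^sub>R w"
    by (simp add: linear_diff[OF T])
  then have "\<gamma> * r = inner z (u - x)"
    using w by (simp add: adj norm_eq_1)
  also have "\<dots> \<le> norm z * norm (u - x)"
    by (rule norm_cauchy_schwarz)
  also have "\<dots> \<le> norm z * r"
    using u by (intro mult_left_mono) (simp_all add: dist_norm norm_minus_commute)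
  finally show ?thesis
    using r by simp
qed

text \<open>By linearity and the adjoint identity the numerator of the quotient vanishes for every
  \<open>u\<close>.\<close>

lemma adjoint_in_Mordukhovich_derivative:
  assumes "linear T" and "\<And>u. inner z u = inner w (T u)"
  shows "z \<in> Mordukhovich_derivative T x w"
  unfolding Mordukhovich_derivative_def
  using assms by (auto simp: linear_diff intro!: Limsup_bounded)

theorem theorem3p1:
  fixes e :: "nat \<Rightarrow> 'h::{real_inner, complete_space}"
    and T :: "'h \<Rightarrow> 'h"
    and xbar ybar :: 'h
  assumes separable: "separable_space (euclidean :: 'h topology)"
    and infinite_dim: "infinite_dimensional TYPE('h)"
    and basis: "orthonormal_basis e"
    and HS: "Hilbert_Schmidt e T"
    and graph: "ybar = T xbar"
  shows "(\<forall>U V. U \<noteq> {} \<and> V \<noteq> {} \<and> (\<exists>x r. r > 0 \<and> cball x r \<subseteq> U \<and> T x \<in> V) \<longrightarrow>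
             \<not> covering_property (as_set_valued T) U V) \<and>
         covering_bound (as_set_valued T) xbar ybar = 0 \<and>
         covering_constant T xbar ybar = 0"
proof -
  have T: "linear T"
    using HS by (simp add: Hilbert_Schmidt_def bounded_linear.linear)
  have norm_e: "norm (e n) = 1" for n
    using basis by (simp add: orthonormal_basis_def norm_eq_1)
  obtain z where adj: "\<And>n u. inner (z n) u = inner (e n) (T u)" and z: "z \<longlonglongrightarrow> 0"
    using Hilbert_Schmidt_adjoint_null_sequence[OF basis HS] by blast
  \<comment> \<open>A single admissible ball suffices: \<gamma> is fixed while the bounds
    \<open>norm (z n)\<close> tend to 0.\<close>
  have no_cover: False
    if "covers_with \<gamma> (as_set_valued T) U V" "\<gamma> > 0" "r > 0" "cball x r \<subseteq> U" "T x \<in> V"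
    for \<gamma> U V r x
  proof -
    have "\<gamma> \<le> norm (z n)" for n
      using covering_modulus_le_adjoint[OF T adj norm_e that] .
    then have "\<gamma> \<le> 0"
      using tendsto_norm[OF z] by (intro LIMSEQ_le_const) auto
    with that show False by simp
  qed
  have "\<not> local_covering_modulus (as_set_valued T) xbar ybar \<gamma>" for \<gamma>
  proof
    assume "local_covering_modulus (as_set_valued T) xbar ybar \<gamma>"
    then obtain U V where "\<gamma> > 0" "xbar \<in> interior U" "T xbar \<in> V"
      and cov: "covers_with \<gamma> (as_set_valued T) U V"
      using interior_subset unfolding local_covering_modulus_def graph by blast
    \<comment> \<open>The ball is centred at \<open>xbar\<close> itself, whose image lies in
      \<open>V\<close>.\<close>
    moreover from this obtain r where "r > 0" "cball xbar r \<subseteq> U"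
      by (auto simp: mem_interior_cball)
    ultimately show False using no_cover by blast
  qed
  \<comment> \<open>No modulus exists, and the empty supremum in \<open>ennreal\<close> is
    0.\<close>
  then have bound: "covering_bound (as_set_valued T) xbar ybar = 0"
    by (simp add: covering_bound_def bot_ennreal)
  have "Inf {ennreal (norm z') | z' x w.
      z' \<in> Mordukhovich_derivative T x w \<and> x \<in> cball xbar \<eta> \<and> T x \<in> cball ybar \<eta> \<and> norm w = 1} = 0"
    (is "Inf ?S = 0") if "\<eta> > 0" for \<eta>
  proof -
    \<comment> \<open>The witnesses are \<open>x = xbar\<close> and \<open>w = e n\<close>, which
      satisfy both ball conditions for every \<eta>.\<close>
    have "ennreal (norm (z n)) \<in> ?S" for n
      using adjoint_in_Mordukhovich_derivative[OF T adj, of n xbar] norm_e that graph by force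
    then have "Inf ?S \<le> ennreal (norm (z n))" for n
      by (rule Inf_lower)
    moreover have "(\<lambda>n. ennreal (norm (z n))) \<longlonglongrightarrow> 0"
      using tendsto_ennrealI[OF tendsto_norm[OF z]] by simp
    ultimately have "Inf ?S \<le> 0"
      by (intro LIMSEQ_le_const) auto
    then show ?thesis by simp
  qed
  then have "covering_constant T xbar ybar = 0"
    by (simp add: covering_constant_def del: mem_cball cong: SUP_cong_simp)
  with bound no_cover show ?thesis
    unfolding covering_property_def by blast
qed

end
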